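(* Let $h:\mathbb{N}\to\mathbb{R}$ be any function with $h(n)\to\infty$ as $n\to\infty$. Then there exists $n_0$ such that for every $n\geq n_0$ and every graph $G$ on $n$ vertices with maximum degree $\Delta\geq h(n)$ and minimum degree $\delta\geq 66\log\Delta$, we have $$w(G)\leq 134\,\frac{n\log\Delta}{\delta}.$$
   Context: Graphs are finite, simple and undirected; $\log$ is the natural logarithm. $N[v]=N(v)\cup\{v\}$ denotes the closed neighborhood of $v$. A watching system of $G$ consists of a finite collection of watchers, each placed on a vertex of $G$ (several watchers may be placed on the same vertex), where each watcher $w$ placed on a vertex $v$ is assigned a nonempty set $Z(w)\subseteq N[v]$, its watching zone, such that for every vertex $x$ the set of watchers $w$ with $x\in Z(w)$ is nonempty, and these sets are different for distinct vertices $x$. The watching number $w(G)$ is the minimum number of watchers in a watching system of $G$. The hypothesis $\Delta\ge h(n)$ with $h(n)\to\infty$ expresses the asymptotic condition $\Delta=\omega(1)$. *)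

theory Defs
  imports "HOL-Analysis.Analysis" "Graph_Theory.Pair_Digraph"
begin

text \<open>
  A finite simple undirected graph is a \<^locale>\<open>pair_graph\<close>: a finite, loop-free digraph whose
  arcs are pairs and whose arc relation is symmetric. Each edge is thus represented by two
  opposite arcs, so the degree of a vertex is its out-degree.
\<close>

definition closed_neighborhood :: "'a pair_pre_digraph \<Rightarrow> 'a \<Rightarrow> 'a set" where
  "closed_neighborhood G v = insert v {u. (v, u) \<in> parcs G}"

definition max_degree :: "'a pair_pre_digraph \<Rightarrow> nat" where
  "max_degree G = Max (out_degree (with_proj G) ` pverts G)"

definition min_degree :: "'a pair_pre_digraph \<Rightarrow> nat" where
  "min_degree G = Min (out_degree (with_proj G) ` pverts G)"

text \<open>
  \<open>W\<close> is the set of watchers, \<open>loc w\<close> the vertex on which \<open>w\<close> is placed and \<open>Z w\<close> its watching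
  zone. Neither \<open>loc\<close> nor \<open>Z\<close> has to be injective.
\<close>

definition watching_system ::
  "'a pair_pre_digraph \<Rightarrow> 'w set \<Rightarrow> ('w \<Rightarrow> 'a) \<Rightarrow> ('w \<Rightarrow> 'a set) \<Rightarrow> bool" where
  "watching_system G W loc Z \<longleftrightarrow>
     finite W \<and>
     (\<forall>w\<in>W. loc w \<in> pverts G \<and> Z w \<noteq> {} \<and> Z w \<subseteq> closed_neighborhood G (loc w)) \<and>
     (\<forall>x\<in>pverts G. {w\<in>W. x \<in> Z w} \<noteq> {}) \<and>
     (\<forall>x\<in>pverts G. \<forall>y\<in>pverts G. x \<noteq> y \<longrightarrow> {w\<in>W. x \<in> Z w} \<noteq> {w\<in>W. y \<in> Z w})"

text \<open>Watchers form a finite collection, so natural numbers suffice as their names.\<close>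

definition watching_number :: "'a pair_pre_digraph \<Rightarrow> nat" where
  "watching_number G =
     (LEAST k. \<exists>(W :: nat set) loc Z. watching_system G W loc Z \<and> card W = k)"

text \<open>The minimum is attained: every graph has a watching system with singleton zones.\<close>

lemma watching_number_attained:
  assumes "pair_graph G"
  shows "\<exists>(W :: nat set) loc Z. watching_system G W loc Z \<and> card W = watching_number G"
proof -
  interpret pair_graph G by fact
  obtain f where f: "bij_betw f {0..<card (pverts G)} (pverts G)"
    using ex_bij_betw_nat_finite[OF pair_finite_verts] by blast
  let ?W = "{0..<card (pverts G)}"
  have surj: "\<exists>i\<in>?W. f i = x" if "x \<in> pverts G" for x
    using f that unfolding bij_betw_def by (metis imageE)
  have into: "f w \<in> pverts G" if "w \<in> ?W" for w
    using f that by (rule bij_betwE[rule_format])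
  have "watching_system G ?W f (\<lambda>w. {f w})"
    unfolding watching_system_def
  proof (intro conjI ballI impI)
    show "f w \<in> pverts G" if "w \<in> ?W" for w
      using that by (rule into)
    show "{f w} \<subseteq> closed_neighborhood G (f w)" for w
      by (simp add: closed_neighborhood_def)
    show "{w \<in> ?W. x \<in> {f w}} \<noteq> {}" if "x \<in> pverts G" for x
      using surj[OF that] by blast
    show "{w \<in> ?W. x \<in> {f w}} \<noteq> {w \<in> ?W. y \<in> {f w}}" if x: "x \<in> pverts G" "x \<noteq> y" for x y
    proof -
      obtain i where "i \<in> ?W" "f i = x"
        using surj[OF x(1)] by blast
      then have "i \<in> {w \<in> ?W. x \<in> {f w}}" "i \<notin> {w \<in> ?W. y \<in> {f w}}"
        using x(2) by simp_all
      then show ?thesis by metis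
    qed
  qed simp_all
  then have "\<exists>k (W :: nat set) loc Z. watching_system G W loc Z \<and> card W = k"
    by blast
  then show ?thesis
    unfolding watching_number_def by (rule LeastI_ex)
qed

end

theory Submission
  imports Defs "HOL-Probability.Product_PMF"
begin

text \<open>
  Put \<open>p = 10 ln \<Delta> / \<delta>\<close>. Independently at every vertex \<open>v\<close>, place with probability \<open>p\<close> a watcher
  whose zone is a uniformly random subset of \<open>N[v]\<close>. A watcher on a vertex of \<open>N[x]\<close> fails to
  separate \<open>x\<close> from a given \<open>y\<close>, and likewise misses \<open>x\<close>, with probability \<open>1 - p/2\<close>, so \<open>x\<close> is
  uncovered, or confused with a given \<open>y\<close>, with probability at most
  \<open>(1 - p/2)^(\<delta> + 1) \<le> \<Delta> powr (-5)\<close>. Covered vertices with disjoint closed neighborhoods are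
  automatically separated, so only \<open>(\<Delta> + 1)\<^sup>2\<close> vertices \<open>y\<close> matter for each \<open>x\<close>. Giving each of the
  few uncovered or confused vertices a watcher of its own with a singleton zone repairs the system,
  and the expected number of watchers used is at most \<open>11 n ln \<Delta> / \<delta>\<close>.
\<close>

section \<open>Sparse random subsets\<close>

text \<open>First-moment argument: if every outcome in the support exceeded the bound, so would the
  expected count, which equals it by linearity. The outcome must lie in the support so that its
  zones are legal.\<close>

lemma exists_card_events_le:
  fixes M :: "'b pmf"
  assumes "finite I"
  shows "\<exists>f\<in>set_pmf M. real (card {i\<in>I. f \<in> A i}) \<le> (\<Sum>i\<in>I. measure_pmf.prob M (A i))"
proof (rule ccontr)
  let ?X = "\<lambda>f. \<Sum>i\<in>I. indicator (A i) f :: real"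
  let ?s = "\<Sum>i\<in>I. measure_pmf.prob M (A i)"
  have card: "real (card {i\<in>I. f \<in> A i}) = ?X f" for f
    using assms by (simp add: indicator_def sum.If_cases Int_def)
  have int: "integrable (measure_pmf M) (indicator (A i) :: 'b \<Rightarrow> real)" for i
    by (rule measure_pmf.integrable_const_bound[where B = 1]) (auto simp: indicator_def)
  assume "\<not> ?thesis"
  then have "?s < measure_pmf.expectation M ?X"
    by (intro measure_pmf.expectation_greater)
      (auto simp: AE_measure_pmf_iff card not_le intro!: Bochner_Integration.integrable_sum int)
  also have "\<dots> = ?s"
    by (subst Bochner_Integration.integral_sum) (auto intro: int)
  finally show False by simp
qed

text \<open>The value \<open>{}\<close> encodes the absence of a watcher, both when the coin fails
  and when the uniform subset happens to be empty.\<close>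

definition sparse_subset_pmf :: "real \<Rightarrow> 'a set \<Rightarrow> 'a set pmf" where
  "sparse_subset_pmf p N =
     bernoulli_pmf p \<bind> (\<lambda>b. if b then pmf_of_set (Pow N) else return_pmf {})"

lemma set_sparse_subset_pmf:
  assumes "finite N"
  shows "set_pmf (sparse_subset_pmf p N) \<subseteq> Pow N"
proof -
  have "set_pmf (pmf_of_set (Pow N)) = Pow N"
    using assms by (intro set_pmf_of_set) auto
  then show ?thesis
    by (auto simp: sparse_subset_pmf_def split: if_splits)
qed

lemma prob_sparse_subset_pmf:
  assumes "0 \<le> p" "p \<le> 1"
  shows "measure_pmf.prob (sparse_subset_pmf p N) A =
           p * measure_pmf.prob (pmf_of_set (Pow N)) A + (1 - p) * indicator A {}"
proof -
  have "measure_pmf.prob (sparse_subset_pmf p N) A = measure_pmf.expectation (bernoulli_pmf p)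
      (\<lambda>b. measure_pmf.prob (if b then pmf_of_set (Pow N) else return_pmf {}) A)"
    using measurable_measure_pmf[of "\<lambda>b. if b then pmf_of_set (Pow N) else return_pmf {}"]
    unfolding sparse_subset_pmf_def measure_pmf_bind
    by (subst measure_pmf.measure_bind[where N = "count_space UNIV"]) auto
  then show ?thesis
    using assms by simp
qed

lemma prob_sparse_subset_nonempty:
  assumes "0 \<le> p" "p \<le> 1"
  shows "measure_pmf.prob (sparse_subset_pmf p N) {S. S \<noteq> {}} \<le> p"
  using assms by (simp add: prob_sparse_subset_pmf mult_left_le)

text \<open>The involution toggling \<open>x\<close> moves every set satisfying \<open>P\<close> to one that does not.\<close>

lemma card_toggle_le:
  assumes "finite N" "x \<in> N" and toggle: "\<And>S. P S \<Longrightarrow> \<not> P (sym_diff S {x})"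
  shows "2 * card (Pow N \<inter> Collect P) \<le> card (Pow N)"
proof -
  let ?A = "Pow N \<inter> Collect P" and ?t = "\<lambda>S. sym_diff S {x}"
  have "inj ?t" by (rule injI) blast
  then have "card (?t ` ?A) = card ?A"
    by (meson card_image inj_on_subset subset_UNIV)
  moreover have "?A \<inter> ?t ` ?A = {}"
    using toggle by blast
  moreover have "finite ?A"
    using assms(1) by simp
  ultimately have "2 * card ?A = card (?A \<union> ?t ` ?A)"
    by (simp add: card_Un_disjoint)
  also have "\<dots> \<le> card (Pow N)"
    using assms by (intro card_mono) auto
  finally show ?thesis .
qed

text \<open>With weight \<open>p\<close> the set is uniform and toggling bounds the event by 1/2;
  with weight \<open>1 - p\<close> the set is empty and the trivial bound 1 is taken.\<close>

lemma prob_sparse_subset_toggle_le: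
  assumes "0 \<le> p" "p \<le> 1" "finite N" "x \<in> N"
    and "\<And>S. P S \<Longrightarrow> \<not> P (sym_diff S {x})"
  shows "measure_pmf.prob (sparse_subset_pmf p N) {S. P S} \<le> 1 - p / 2"
proof -
  have ne: "Pow N \<noteq> {}" by blast
  have "real (2 * card (Pow N \<inter> Collect P)) \<le> real (card (Pow N))"
    unfolding of_nat_le_iff by (rule card_toggle_le) (fact assms(3-5))+
  moreover have "0 < card (Pow N)"
    using assms(3) by (simp add: card_gt_0_iff ne)
  ultimately have "measure_pmf.prob (pmf_of_set (Pow N)) (Collect P) \<le> 1 / 2"
    using assms(3) by (simp add: measure_pmf_of_set[OF ne] field_simps del: card_Pow)
  then have "p * measure_pmf.prob (pmf_of_set (Pow N)) (Collect P) \<le> p * (1 / 2)"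
    using assms(1) by (rule mult_left_mono)
  moreover have "(1 - p) * indicator (Collect P) {} \<le> 1 - p"
    using assms(2) by (auto simp: indicator_def)
  ultimately show ?thesis
    using assms(1,2) by (simp add: prob_sparse_subset_pmf)
qed

text \<open>Independence gives a product over \<open>V\<close>; factors outside \<open>U\<close> are
  bounded by 1. Later \<open>U\<close> is a closed neighborhood and \<open>V\<close> the whole
  vertex set.\<close>

lemma prob_Pi_pmf_subset_le:
  assumes "finite V" "U \<subseteq> V" "0 \<le> c"
    and "\<And>v. v \<in> U \<Longrightarrow> measure_pmf.prob (q v) B \<le> c"
  shows "measure_pmf.prob (Pi_pmf V d q) {f. \<forall>v\<in>V. f v \<in> B} \<le> c ^ card U"
proof -
  have "{f. \<forall>v\<in>V. f v \<in> B} = Pi V (\<lambda>_. B)"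
    by auto
  then have "measure_pmf.prob (Pi_pmf V d q) {f. \<forall>v\<in>V. f v \<in> B} =
      (\<Prod>v\<in>V. measure_pmf.prob (q v) B)"
    using assms(1) by (simp add: measure_Pi_pmf_Pi)
  also have "\<dots> = (\<Prod>v\<in>U. measure_pmf.prob (q v) B) * (\<Prod>v\<in>V - U. measure_pmf.prob (q v) B)"
    using assms(1,2) by (metis mult.commute prod.subset_diff)
  also have "\<dots> \<le> (\<Prod>v\<in>U. c) * 1"
    using assms by (intro mult_mono prod_mono prod_le_1 prod_nonneg) auto
  finally show ?thesis by simp
qed

section \<open>Watching systems from zone assignments\<close>

text \<open>Enumerating the watchers transfers a system over any type of names, such as the sum type
  used below, to the natural numbers of the definition.\<close>

lemma watching_number_le:
  assumes "watching_system G (W :: 'w set) loc Z"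
  shows "watching_number G \<le> card W"
proof -
  have "finite W"
    using assms by (simp add: watching_system_def)
  then obtain g n where W: "W = g ` {0..<n}" and n: "n = card W"
    using ex_bij_betw_nat_finite bij_betw_imp_surj_on by metis
  let ?N = "{0..<n}"
  \<comment> \<open>Each old code is the \<open>g\<close>-image of the new one, so nonempty or
    distinct old codes force the same of the new ones.\<close>
  have codes: "{w \<in> W. x \<in> Z w} = g ` {i \<in> ?N. x \<in> Z (g i)}" for x
    unfolding W by blast
  have "{i \<in> ?N. x \<in> Z (g i)} \<noteq> {i \<in> ?N. y \<in> Z (g i)}"
    if "x \<in> pverts G" "y \<in> pverts G" "x \<noteq> y" for x y
    using assms that codes[of x] codes[of y] unfolding watching_system_def by metis
  moreover have "{i \<in> ?N. x \<in> Z (g i)} \<noteq> {}" if "x \<in> pverts G" for x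
    using assms that codes[of x] unfolding watching_system_def by (metis image_empty)
  moreover have "loc (g i) \<in> pverts G \<and> Z (g i) \<noteq> {} \<and>
      Z (g i) \<subseteq> closed_neighborhood G (loc (g i))" if "i \<in> ?N" for i
  proof -
    have "g i \<in> W"
      using that by (simp add: W)
    then show ?thesis
      using assms by (simp add: watching_system_def)
  qed
  ultimately have "watching_system G ?N (loc \<circ> g) (Z \<circ> g)"
    by (simp add: watching_system_def)
  then have "\<exists>(W' :: nat set) loc Z. watching_system G W' loc Z \<and> card W' = card W"
    by (intro exI[of _ ?N]) (auto simp: n)
  then show ?thesis
    unfolding watching_number_def by (rule Least_le)
qed

section \<open>Closed neighborhoods and vertices that can share a watcher\<close>

context pair_graph
begin

lemma in_closed_neighborhood_sym:
  "u \<in> closed_neighborhood G v \<longleftrightarrow> v \<in> closed_neighborhood G u"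
  using arcs_symmetric by (auto simp: closed_neighborhood_def)

lemma closed_neighborhood_subset:
  "v \<in> pverts G \<Longrightarrow> closed_neighborhood G v \<subseteq> pverts G"
  using in_arcsD2 by (auto simp: closed_neighborhood_def)

lemma finite_closed_neighborhood: "finite (closed_neighborhood G v)"
proof -
  have "finite {u. (v, u) \<in> parcs G}"
    using in_arcsD2 by (intro finite_subset[OF _ pair_finite_verts]) auto
  then show ?thesis
    by (simp add: closed_neighborhood_def)
qed

lemma card_closed_neighborhood:
  "card (closed_neighborhood G v) = Suc (out_degree (with_proj G) v)"
proof -
  have "out_arcs (with_proj G) v = Pair v ` {u. (v, u) \<in> parcs G}"
    by (auto simp: out_arcs_def)
  then have "out_degree (with_proj G) v = card {u. (v, u) \<in> parcs G}"
    unfolding out_degree_def by (simp add: card_image inj_on_def)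
  moreover have "finite {u. (v, u) \<in> parcs G}"
    using finite_closed_neighborhood[of v] by (simp add: closed_neighborhood_def)
  moreover have "(v, v) \<notin> parcs G"
    using pair_no_loops by fastforce
  ultimately show ?thesis
    by (simp add: closed_neighborhood_def)
qed

lemma card_closed_neighborhood_le:
  "v \<in> pverts G \<Longrightarrow> card (closed_neighborhood G v) \<le> Suc (max_degree G)"
  unfolding card_closed_neighborhood max_degree_def using pair_finite_verts by simp

lemma card_closed_neighborhood_ge:
  "v \<in> pverts G \<Longrightarrow> Suc (min_degree G) \<le> card (closed_neighborhood G v)"
  unfolding card_closed_neighborhood min_degree_def using pair_finite_verts by simp

definition watchers_of :: "('a \<Rightarrow> 'a set) \<Rightarrow> 'a \<Rightarrow> 'a set" where
  "watchers_of f x = {v \<in> pverts G. x \<in> f v}"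

text \<open>The punctured ball of radius two: the only vertices that can share a watcher with
  \<open>x\<close>.\<close>

definition vertices_near :: "'a \<Rightarrow> 'a set" where
  "vertices_near x = (\<Union>v\<in>closed_neighborhood G x. closed_neighborhood G v) - {x}"

definition ill_watched :: "('a \<Rightarrow> 'a set) \<Rightarrow> 'a \<Rightarrow> bool" where
  "ill_watched f x \<longleftrightarrow> watchers_of f x = {} \<or>
     (\<exists>y\<in>vertices_near x. watchers_of f x = watchers_of f y)"

lemma finite_vertices_near: "finite (vertices_near x)"
  by (simp add: vertices_near_def finite_closed_neighborhood)

lemma card_vertices_near_le:
  assumes "x \<in> pverts G"
  shows "card (vertices_near x) \<le> (Suc (max_degree G))\<^sup>2"
proof -
  have "card (vertices_near x) \<le> card (\<Union>v\<in>closed_neighborhood G x. closed_neighborhood G v)"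
    by (intro card_mono) (auto simp: vertices_near_def finite_closed_neighborhood)
  also have "\<dots> \<le> (\<Sum>v\<in>closed_neighborhood G x. card (closed_neighborhood G v))"
    by (rule card_UN_le) (rule finite_closed_neighborhood)
  also have "\<dots> \<le> (\<Sum>v\<in>closed_neighborhood G x. Suc (max_degree G))"
    using closed_neighborhood_subset[OF assms] card_closed_neighborhood_le
    by (intro sum_mono) blast
  also have "\<dots> \<le> (Suc (max_degree G))\<^sup>2"
    using card_closed_neighborhood_le[OF assms]
    by (simp only: sum_constant power2_eq_square of_nat_id mult_le_mono1)
  finally show ?thesis .
qed

text \<open>
  The index \<open>Inl v\<close> stands for the watcher on \<open>v\<close> with zone \<open>f v\<close>, and \<open>Inr x\<close> for the repairing
  watcher on \<open>x\<close> with zone \<open>{x}\<close>.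
\<close>

definition repair_watchers :: "('a + 'a) \<Rightarrow> ('a \<Rightarrow> 'a set) set" where
  "repair_watchers = case_sum (\<lambda>v. {f. f v \<noteq> {}}) (\<lambda>x. {f. ill_watched f x})"

lemma watching_system_repair:
  assumes f: "\<And>v. v \<in> pverts G \<Longrightarrow> f v \<subseteq> closed_neighborhood G v"
  shows "watching_system G {i \<in> pverts G <+> pverts G. f \<in> repair_watchers i}
           (case_sum id id) (case_sum f (\<lambda>x. {x}))"
    (is "watching_system G ?W ?loc ?Z")
proof -
  let ?code = "\<lambda>x. {w \<in> ?W. x \<in> ?Z w}"
  have Inl_iff: "Inl v \<in> ?code x \<longleftrightarrow> v \<in> watchers_of f x" for v x
    by (auto simp: watchers_of_def repair_watchers_def)
  have Inr_iff: "Inr v \<in> ?code x \<longleftrightarrow> v = x \<and> x \<in> pverts G \<and> ill_watched f x" for v x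
    by (auto simp: repair_watchers_def)
  have covered: "?code x \<noteq> {}" if "x \<in> pverts G" for x
  proof (cases "ill_watched f x")
    case True
    then show ?thesis using Inr_iff[of x x] that by blast
  next
    case False
    then obtain v where "v \<in> watchers_of f x"
      by (auto simp: ill_watched_def)
    then show ?thesis using Inl_iff[of v x] by blast
  qed
  have separated: "?code x \<noteq> ?code y" if "x \<in> pverts G" "x \<noteq> y" for x y
  proof
    assume eq: "?code x = ?code y"
    then have same: "watchers_of f x = watchers_of f y"
      using Inl_iff by blast
    \<comment> \<open>Otherwise \<open>Inr x\<close> would belong to the code of \<open>x\<close>
      but not to that of \<open>y\<close>.\<close>
    have well: "\<not> ill_watched f x"
      using Inr_iff[of x] eq that by blast
    then obtain v where v: "v \<in> watchers_of f x"
      by (auto simp: ill_watched_def)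
    \<comment> \<open>The watcher on \<open>v\<close> sees both vertices, so they are within
      distance two, where \<open>ill_watched\<close> already excludes equal codes.\<close>
    then have "x \<in> closed_neighborhood G v" "y \<in> closed_neighborhood G v"
      using f same by (auto simp: watchers_of_def)
    then have "y \<in> vertices_near x"
      using that(2) in_closed_neighborhood_sym by (auto simp: vertices_near_def)
    then show False
      using well same by (auto simp: ill_watched_def)
  qed
  have "finite ?W"
    using pair_finite_verts by simp
  moreover have "?loc w \<in> pverts G \<and> ?Z w \<noteq> {} \<and> ?Z w \<subseteq> closed_neighborhood G (?loc w)"
    if "w \<in> ?W" for w
  proof (cases w)
    case (Inl v)
    then show ?thesis
      using that f[of v] by (auto simp: repair_watchers_def)
  next
    case (Inr x)
    then show ?thesis
      using that by (auto simp: closed_neighborhood_def)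
  qed
  ultimately show ?thesis
    unfolding watching_system_def using covered separated by blast
qed

section \<open>The expected number of watchers\<close>

abbreviation random_zones :: "real \<Rightarrow> ('a \<Rightarrow> 'a set) pmf" where
  "random_zones p \<equiv> Pi_pmf (pverts G) {} (\<lambda>v. sparse_subset_pmf p (closed_neighborhood G v))"

lemma random_zones_subset:
  assumes "f \<in> set_pmf (random_zones p)" "v \<in> pverts G"
  shows "f v \<subseteq> closed_neighborhood G v"
  using assms set_Pi_pmf_subset'[OF pair_finite_verts]
    set_sparse_subset_pmf[OF finite_closed_neighborhood, of p v]
  by (fastforce simp: PiE_dflt_def)

text \<open>For \<open>v\<close> in the closed neighborhood of \<open>x\<close>, symmetry puts
  \<open>x\<close> into that of \<open>v\<close>, so toggling \<open>x\<close> acts on the possible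
  zones at \<open>v\<close>. There are at least \<open>Suc (min_degree G)\<close> such independent
  zones.\<close>

lemma prob_random_zones_toggle_le:
  assumes p: "0 \<le> p" "p \<le> 1" and x: "x \<in> pverts G"
    and toggle: "\<And>S. P S \<Longrightarrow> \<not> P (sym_diff S {x})"
  shows "measure_pmf.prob (random_zones p) {f. \<forall>v\<in>pverts G. P (f v)}
           \<le> (1 - p / 2) ^ Suc (min_degree G)"
proof -
  have "measure_pmf.prob (random_zones p) {f. \<forall>v\<in>pverts G. f v \<in> Collect P}
      \<le> (1 - p / 2) ^ card (closed_neighborhood G x)"
    using p toggle in_closed_neighborhood_sym
    by (intro prob_Pi_pmf_subset_le prob_sparse_subset_toggle_le[where x = x]
        pair_finite_verts closed_neighborhood_subset x finite_closed_neighborhood) auto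
  also have "\<dots> \<le> (1 - p / 2) ^ Suc (min_degree G)"
    using p by (intro power_decreasing card_closed_neighborhood_ge x) auto
  finally show ?thesis by simp
qed

text \<open>Union bound: one event for \<open>x\<close> being unwatched, and at most
  \<open>(\<Delta> + 1)\<^sup>2\<close> for confusion with a nearby vertex.\<close>

lemma prob_ill_watched_le:
  assumes p: "0 \<le> p" "p \<le> 1" and x: "x \<in> pverts G"
  shows "measure_pmf.prob (random_zones p) {f. ill_watched f x}
           \<le> (1 + (real (max_degree G) + 1)\<^sup>2) * (1 - p / 2) ^ Suc (min_degree G)"
proof -
  let ?pr = "measure_pmf.prob (random_zones p)" and ?c = "(1 - p / 2) ^ Suc (min_degree G)"
  let ?same = "\<lambda>y. {f. \<forall>v\<in>pverts G. x \<in> f v \<longleftrightarrow> y \<in> f v}"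
  have none: "?pr {f. \<forall>v\<in>pverts G. x \<notin> f v} \<le> ?c"
    by (rule prob_random_zones_toggle_le[OF p x]) auto
  \<comment> \<open>Since \<open>y\<close> differs from \<open>x\<close>, toggling \<open>x\<close>
    flips membership of \<open>x\<close> but not of \<open>y\<close>, which destroys their
    agreement.\<close>
  have same: "?pr (?same y) \<le> ?c" if "y \<in> vertices_near x" for y
    using that by (intro prob_random_zones_toggle_le[OF p x]) (auto simp: vertices_near_def)
  have c: "0 \<le> ?c"
    using p by simp
  have "{f. ill_watched f x} =
      {f. \<forall>v\<in>pverts G. x \<notin> f v} \<union> (\<Union>y\<in>vertices_near x. ?same y)"
    by (auto simp: ill_watched_def watchers_of_def set_eq_iff)
  also have "?pr \<dots> \<le> ?pr {f. \<forall>v\<in>pverts G. x \<notin> f v} + ?pr (\<Union>y\<in>vertices_near x. ?same y)"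
    by (rule measure_Un_le) auto
  also have "?pr (\<Union>y\<in>vertices_near x. ?same y) \<le> (\<Sum>y\<in>vertices_near x. ?pr (?same y))"
    by (rule measure_pmf.finite_measure_subadditive_finite) (auto simp: finite_vertices_near)
  also have "\<dots> \<le> real (card (vertices_near x)) * ?c"
    using same by (rule sum_bounded_above)
  also have "\<dots> \<le> (real (max_degree G) + 1)\<^sup>2 * ?c"
  proof (rule mult_right_mono[OF _ c])
    have "real (card (vertices_near x)) \<le> real ((Suc (max_degree G))\<^sup>2)"
      using card_vertices_near_le[OF x] by (simp only: of_nat_le_iff)
    then show "real (card (vertices_near x)) \<le> (real (max_degree G) + 1)\<^sup>2"
      by (simp add: add.commute)
  qed
  finally show ?thesis
    using none unfolding distrib_right mult_1_left by linarith
qed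

lemma watching_number_le_expectation:
  assumes p: "0 \<le> p" "p \<le> 1"
  shows "real (watching_number G) \<le> real (card (pverts G)) *
           (p + (1 + (real (max_degree G) + 1)\<^sup>2) * (1 - p / 2) ^ Suc (min_degree G))"
proof -
  let ?V = "pverts G" and ?pr = "measure_pmf.prob (random_zones p)"
  let ?b = "(1 + (real (max_degree G) + 1)\<^sup>2) * (1 - p / 2) ^ Suc (min_degree G)"
  have "finite (?V <+> ?V)"
    using pair_finite_verts by simp
  from exists_card_events_le[OF this, of "random_zones p" repair_watchers]
  obtain f where f: "f \<in> set_pmf (random_zones p)"
    and le: "real (card {i \<in> ?V <+> ?V. f \<in> repair_watchers i})
      \<le> (\<Sum>i\<in>?V <+> ?V. ?pr (repair_watchers i))"
    by blast
  have nonempty: "?pr {f. f v \<noteq> {}} \<le> p" if "v \<in> ?V" for v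
  proof -
    have "?pr {f. f v \<noteq> {}} = measure_pmf.prob (map_pmf (\<lambda>f. f v) (random_zones p)) {S. S \<noteq> {}}"
      by (simp add: vimage_def)
    \<comment> \<open>The marginal of a product distribution at \<open>v\<close> is its factor
      there.\<close>
    also have "map_pmf (\<lambda>f. f v) (random_zones p) = sparse_subset_pmf p (closed_neighborhood G v)"
      using that pair_finite_verts by (simp add: Pi_pmf_component)
    finally show ?thesis
      using prob_sparse_subset_nonempty[OF p] by simp
  qed
  have "real (watching_number G) \<le> real (card {i \<in> ?V <+> ?V. f \<in> repair_watchers i})"
    using watching_number_le[OF watching_system_repair] random_zones_subset[OF f] by simp
  also note le
  also have "(\<Sum>i\<in>?V <+> ?V. ?pr (repair_watchers i)) =
      (\<Sum>v\<in>?V. ?pr {f. f v \<noteq> {}}) + (\<Sum>x\<in>?V. ?pr {f. ill_watched f x})"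
    using pair_finite_verts by (simp add: sum.Plus repair_watchers_def)
  also have "\<dots> \<le> real (card ?V) * p + real (card ?V) * ?b"
    using nonempty prob_ill_watched_le[OF p] by (intro add_mono sum_bounded_above) auto
  finally show ?thesis
    by (simp add: distrib_left)
qed

text \<open>The factor 10 in \<open>p\<close> makes the failure probability at most
  \<open>1 / D ^ 5\<close>. This outweighs the union bound factor \<open>D ^ 3\<close>, and the
  remaining \<open>1 / D\<^sup>2\<close> is at most \<open>ln D / d\<close>, which raises 10 to
  11.\<close>

theorem watching_number_le_log:
  assumes "pverts G \<noteq> {}" and D: "3 \<le> max_degree G"
    and d: "10 * ln (real (max_degree G)) \<le> real (min_degree G)"
  shows "real (watching_number G)
           \<le> 11 * (real (card (pverts G)) * ln (real (max_degree G)) / real (min_degree G))"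
proof -
  define n where "n = real (card (pverts G))"
  define D where "D = real (max_degree G)"
  define d where "d = real (min_degree G)"
  define p where "p = 10 * ln D / d"
  have D3: "3 \<le> D"
    using D by (simp add: D_def)
  have ln1: "1 \<le> ln D"
    using D3 exp_le by (subst ln_ge_iff) auto
  have d10: "10 * ln D \<le> d"
    using d by (simp add: D_def d_def)
  then have d0: "0 < d"
    using ln1 by linarith
  have p: "0 \<le> p" "p \<le> 1"
    using ln1 d10 d0 by (auto simp: p_def)
  obtain x where "x \<in> pverts G"
    using assms(1) by blast
  then have "min_degree G \<le> max_degree G"
    using card_closed_neighborhood_ge card_closed_neighborhood_le order_trans Suc_le_mono by blast
  then have dD: "d \<le> D"
    by (simp add: D_def d_def)
  have "(1 - p / 2) ^ Suc (min_degree G) \<le> (1 - p / 2) ^ min_degree G"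
    using p by (intro power_decreasing) auto
  also have "\<dots> \<le> exp (- (p / 2)) ^ min_degree G"
    using p exp_ge_add_one_self[of "- (p / 2)"] by (intro power_mono) auto
  also have "\<dots> = exp (- (d * (p / 2)))"
    by (simp add: exp_of_nat_mult[symmetric] d_def)
  also have "d * (p / 2) = 5 * ln D"
    using d0 by (simp add: p_def)
  also have "exp (- (5 * ln D)) = 1 / D ^ 5"
    using D3 exp_of_nat_mult[of 5 "ln D"] by (simp add: exp_minus field_simps)
  finally have fail: "(1 - p / 2) ^ Suc (min_degree G) \<le> 1 / D ^ 5" .
  \<comment> \<open>This product bound makes the quadratic inequality below linear in
    \<open>D\<close> and \<open>D * D\<close>.\<close>
  have "D * 3 \<le> D * D"
    using D3 by (intro mult_left_mono) auto
  then have "1 + (D + 1)\<^sup>2 \<le> 3 * D\<^sup>2"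
    using D3 unfolding power2_eq_square distrib_left distrib_right by linarith
  also have "\<dots> \<le> D ^ 3"
    using D3 by (simp add: power3_eq_cube power2_eq_square)
  finally have "(1 + (D + 1)\<^sup>2) * (1 - p / 2) ^ Suc (min_degree G) \<le> D ^ 3 * (1 / D ^ 5)"
    using fail D3 p by (intro mult_mono) auto
  also have "\<dots> = 1 / D\<^sup>2"
    using D3 by (simp add: field_simps flip: power_add)
  also have "\<dots> \<le> 1 / D"
    using D3 by (simp add: power2_eq_square field_simps)
  \<comment> \<open>Uses \<open>1 \<le> ln D\<close> and that the minimum degree is at most the
    maximum degree.\<close>
  also have "\<dots> \<le> ln D / d"
    using dD d0 ln1 D3 by (intro frac_le) auto
  finally have "p + (1 + (D + 1)\<^sup>2) * (1 - p / 2) ^ Suc (min_degree G) \<le> 11 * (ln D / d)"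
    by (simp add: p_def)
  then have "n * (p + (1 + (D + 1)\<^sup>2) * (1 - p / 2) ^ Suc (min_degree G))
      \<le> n * (11 * (ln D / d))"
    by (intro mult_left_mono) (auto simp: n_def)
  then show ?thesis
    using watching_number_le_expectation[OF p] unfolding n_def D_def d_def by (simp add: mult.left_commute)
qed

end

theorem corollary16:
  fixes h :: "nat \<Rightarrow> real"
  assumes "filterlim h at_top sequentially"
  shows "\<exists>n0. \<forall>n\<ge>n0. \<forall>G :: 'a pair_pre_digraph.
           pair_graph G \<and> card (pverts G) = n \<and>
           real (max_degree G) \<ge> h n \<and>
           real (min_degree G) \<ge> 66 * ln (real (max_degree G)) \<longrightarrow>
           real (watching_number G)
             \<le> 134 * (real n * ln (real (max_degree G)) / real (min_degree G))"
proof -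
  have "eventually (\<lambda>n. 3 \<le> h n) sequentially"
    using assms by (simp add: filterlim_at_top)
  then obtain n0 where n0: "\<And>n. n0 \<le> n \<Longrightarrow> 3 \<le> h n"
    by (auto simp: eventually_sequentially)
  show ?thesis
  \<comment> \<open>The maximum with 1 makes the vertex set nonempty; \<open>n0\<close> yields
    maximum degree at least 3.\<close>
  proof (intro exI[of _ "max n0 1"] allI impI, elim conjE)
    fix n and G :: "'a pair_pre_digraph"
    assume n: "max n0 1 \<le> n" and G: "pair_graph G" and card: "card (pverts G) = n"
      and D: "h n \<le> real (max_degree G)"
      and d: "66 * ln (real (max_degree G)) \<le> real (min_degree G)"
    interpret pair_graph G by fact
    have D3: "3 \<le> max_degree G"
      using n0[of n] n D by simp
    then have ln: "0 \<le> ln (real (max_degree G))"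
      by simp
    have "real (watching_number G)
        \<le> 11 * (real n * ln (real (max_degree G)) / real (min_degree G))"
      using watching_number_le_log n card D3 d ln by fastforce
    also have "\<dots> \<le> 134 * (real n * ln (real (max_degree G)) / real (min_degree G))"
      using ln by (intro mult_right_mono) auto
    finally show "real (watching_number G)
        \<le> 134 * (real n * ln (real (max_degree G)) / real (min_degree G))" .
  qed
qed

end
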